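(* Let $n,k\ge 1$ be integers and let $\mathcal{F}$ be a $k$-uniform set system on $[n]$ which is intersecting and shifted. For $0\le i\le k-1$ let $\mathcal{F}_i$ be the collection of sets of type $i$ in $\mathcal{F}$. Then $\mathcal{F}=\bigcup_{i=0}^{k-1}\mathcal{F}_i$, and for every $i\in\{0,\dots,k-1\}$ and every $S\in\mathcal{F}_i$ one has $|S\cap[2k-i-1]|=k-i$ and $2k-i\notin S$.
   Context: For an integer $m\ge 0$, $[m]=\{1,2,\dots,m\}$ (a set of integers; $m$ may exceed $n$). A $k$-uniform set system on $[n]$ is a collection of $k$-element subsets of $[n]$. It is intersecting if any two of its sets have nonempty intersection. It is shifted if for all $i<j$ in $[n]$ and all $S\in\mathcal{F}$ with $j\in S$ and $i\notin S$, the set $(S\setminus\{j\})\cup\{i\}$ belongs to $\mathcal{F}$. A set $S\in\mathcal{F}$ has type $i$ (where $0\le i\le k-1$) if $i$ is the smallest integer in $\{0,1,\dots,k-1\}$ satisfying $|S\cap[2k-i-1]|\ge k-i$; and $\mathcal{F}_i=\{S\in\mathcal{F}: S \text{ has type } i\}$. *)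

theory Defs
  imports Main
begin

definition uniform_system :: "nat \<Rightarrow> nat \<Rightarrow> nat set set \<Rightarrow> bool" where
  "uniform_system n k F \<longleftrightarrow> (\<forall>S\<in>F. S \<subseteq> {1..n} \<and> card S = k)"

definition intersecting :: "nat set set \<Rightarrow> bool" where
  "intersecting F \<longleftrightarrow> (\<forall>A\<in>F. \<forall>B\<in>F. A \<inter> B \<noteq> {})"

definition shifted :: "nat \<Rightarrow> nat set set \<Rightarrow> bool" where
  "shifted n F \<longleftrightarrow>
     (\<forall>i\<in>{1..n}. \<forall>j\<in>{1..n}. i < j \<longrightarrow>
       (\<forall>S\<in>F. j \<in> S \<and> i \<notin> S \<longrightarrow> insert i (S - {j}) \<in> F))"

(* No subtraction below truncates, since i < k. The interval {1..2 * k - i - 1}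
   is not restricted to {1..n}. *)
definition type_cond :: "nat \<Rightarrow> nat set \<Rightarrow> nat \<Rightarrow> bool" where
  "type_cond k S i \<longleftrightarrow> i < k \<and> card (S \<inter> {1..2 * k - i - 1}) \<ge> k - i"

(* Stated as a relation rather than with LEAST, so that a set for which no index
   satisfies the condition has no type. *)
definition has_type :: "nat \<Rightarrow> nat set \<Rightarrow> nat \<Rightarrow> bool" where
  "has_type k S i \<longleftrightarrow> type_cond k S i \<and> (\<forall>j. type_cond k S j \<longrightarrow> i \<le> j)"

definition type_family :: "nat \<Rightarrow> nat set set \<Rightarrow> nat \<Rightarrow> nat set set" where
  "type_family k F i = {S \<in> F. has_type k S i}"

end

theory Submission
  imports Defs
begin

text \<open>
  Reading \<open>j = k - i\<close>, a set satisfies the type condition at \<open>i\<close> iff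
  it has at least \<open>j\<close> elements in \<open>[k + j - 1]\<close>, and its type corresponds to
  the largest such \<open>j\<close> in \<open>{1..k}\<close>.

  The heart of the matter is that every \<open>S\<close> in the family has a type. If not, then for every
  \<open>x \<in> S\<close> at least \<open>k\<close> elements of \<open>[x]\<close> lie outside \<open>S\<close>
  (lemma \<open>many_nonelements_below\<close>). Choose \<open>T\<close> in the family
  with \<open>|S \<inter> T|\<close> minimal. As the family is intersecting, some \<open>x\<close> lies in \<open>S \<inter> T\<close>;
  since \<open>T - {x}\<close> has only \<open>k - 1\<close> elements, there is a \<open>y < x\<close> outside both
  \<open>S\<close> and \<open>T\<close>. Replacing \<open>x\<close> by \<open>y\<close> in \<open>T\<close> stays in the shifted family and
  lowers the intersection, a contradiction (lemma \<open>exists_type_cond\<close>).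

  The equality \<open>|S \<inter> [k + j - 1]| = j\<close> and \<open>k + j \<notin> S\<close> then follow from maximality
  of \<open>j\<close>: for \<open>j < k\<close> the condition fails at \<open>j + 1\<close>, so \<open>|S \<inter> [k + j]| \<le> j\<close>;
  for \<open>j = k\<close> all of \<open>S\<close> is already contained in \<open>[2k - 1]\<close>
  (lemma \<open>has_type_exact\<close>).
\<close>

lemma many_nonelements_below:
  assumes no: "\<And>i. \<not> type_cond k S i"
    and S: "finite S" "card S = k" "0 \<notin> S" and x: "x \<in> S"
  shows "k \<le> card ({1..x} - S)"
proof -
  define m where "m = card (S \<inter> {1..x})"
  have "x \<in> S \<inter> {1..x}" using x S(3) by (cases "x = 0") auto
  then have m1: "1 \<le> m" unfolding m_def by (metis S(1) One_nat_def Suc_leI card_gt_0_iff empty_iff finite_Int)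
  have mk: "m \<le> k" unfolding m_def using S by (metis card_mono inf_le1)
  \<comment> \<open>The failure of the type condition at \<open>i = k - m\<close>.\<close>
  have less: "card (S \<inter> {1..k + m - 1}) < m"
    using no[of "k - m"] m1 mk by (simp add: type_cond_def mult_2)
  have "k + m \<le> x"
  proof (rule ccontr)
    assume "\<not> k + m \<le> x"
    then have "S \<inter> {1..x} \<subseteq> S \<inter> {1..k + m - 1}" by auto
    then have "m \<le> card (S \<inter> {1..k + m - 1})" unfolding m_def by (intro card_mono) auto
    with less show False by simp
  qed
  moreover have "card ({1..x} - S) = x - m"
    using card_Diff_subset_Int[of "{1..x}" S] by (simp add: m_def Int_commute)
  ultimately show ?thesis by simp
qed

lemma exists_type_cond:
  assumes U: "uniform_system n k F" and I: "intersecting F" and Sh: "shifted n F"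
    and SF: "S \<in> F"
  shows "\<exists>i. type_cond k S i"
proof (rule ccontr)
  assume no: "\<nexists>i. type_cond k S i"
  have fin: "finite A" and cardk: "card A = k" and sub: "A \<subseteq> {1..n}" if "A \<in> F" for A
    using U that finite_subset[of A "{1..n}"] unfolding uniform_system_def by auto
  obtain T where T: "T \<in> F" and min: "\<And>T'. T' \<in> F \<Longrightarrow> card (S \<inter> T) \<le> card (S \<inter> T')"
    using ex_has_least_nat[of "\<lambda>A. A \<in> F" S "\<lambda>A. card (S \<inter> A)"] SF by auto
  from I SF T obtain x where x: "x \<in> S" "x \<in> T" unfolding intersecting_def by blast
  have "0 \<notin> S" using sub[OF SF] by auto
  then have "k \<le> card ({1..x} - S)"
    using many_nonelements_below[of k S x] no fin[OF SF] cardk[OF SF] x by blast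
  moreover have "card (T - {x}) < k"
    using card_Diff1_less[OF fin[OF T] x(2)] cardk[OF T] by simp
  ultimately have "\<not> {1..x} - S \<subseteq> T - {x}"
    using card_mono[of "T - {x}" "{1..x} - S"] fin[OF T] by auto
  then obtain y where y: "y \<in> {1..x}" "y \<notin> S" "y \<notin> T" using x by blast
  have "y < x" using y x by (metis atLeastAtMost_iff le_neq_implies_less)
  moreover have "x \<in> {1..n}" using sub[OF T] x by blast
  ultimately have "insert y (T - {x}) \<in> F"
    using Sh T x y unfolding shifted_def by auto
  from min[OF this] have "card (S \<inter> T) \<le> card (S \<inter> T - {x})"
    using y by (simp add: Int_Diff)
  moreover have "card (S \<inter> T - {x}) < card (S \<inter> T)"
    using x fin[OF T] by (intro card_Diff1_less) auto
  ultimately show False by simp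
qed

lemma has_type_exact:
  assumes S: "finite S" "card S = k" and t: "has_type k S i"
  shows "card (S \<inter> {1..2 * k - i - 1}) = k - i \<and> 2 * k - i \<notin> S"
proof -
  let ?A = "S \<inter> {1..2 * k - i - 1}"
  from t have ik: "i < k" and ge: "k - i \<le> card ?A"
    and least: "\<And>j. type_cond k S j \<Longrightarrow> i \<le> j"
    unfolding has_type_def type_cond_def by auto
  show ?thesis
  proof (cases i)
    case 0
    have "?A = S" using card_seteq[OF S(1), of ?A] ge S(2) 0 by simp
    moreover have "2 * k - i \<notin> ?A" using ik by auto
    ultimately show ?thesis using S(2) 0 by simp
  next
    case (Suc j)
    have "\<not> type_cond k S j" using least[of j] Suc by auto
    moreover have "2 * k - j - 1 = 2 * k - i" using Suc by simp
    ultimately have le: "card (S \<inter> {1..2 * k - i}) \<le> k - i"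
      using Suc ik unfolding type_cond_def by auto
    have mono: "card ?A \<le> card (S \<inter> {1..2 * k - i})"
      by (intro card_mono) auto
    have "2 * k - i \<notin> S"
    proof
      assume "2 * k - i \<in> S"
      then have "insert (2 * k - i) ?A \<subseteq> S \<inter> {1..2 * k - i}" using ik by auto
      then have "card (insert (2 * k - i) ?A) \<le> card (S \<inter> {1..2 * k - i})"
        by (intro card_mono) auto
      moreover have "2 * k - i \<notin> ?A" using ik by auto
      ultimately show False using ge le by simp
    qed
    then show ?thesis using ge le mono by simp
  qed
qed

theorem lemma2p5:
  fixes n k :: nat and F :: "nat set set"
  assumes "n \<ge> 1" and "k \<ge> 1"
    and "uniform_system n k F"
    and "intersecting F"
    and "shifted n F"
  shows "F = (\<Union>i\<in>{0..k - 1}. type_family k F i) \<and>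
    (\<forall>i\<in>{0..k - 1}. \<forall>S\<in>type_family k F i.
       card (S \<inter> {1..2 * k - i - 1}) = k - i \<and> 2 * k - i \<notin> S)"
proof (intro conjI)
  have "\<exists>i\<in>{0..k - 1}. S \<in> type_family k F i" if "S \<in> F" for S
  proof -
    have ex: "\<exists>i. type_cond k S i" using exists_type_cond assms(3-5) that by blast
    define i where "i = (LEAST i. type_cond k S i)"
    have "has_type k S i"
      unfolding has_type_def i_def using ex by (auto intro: LeastI_ex Least_le)
    moreover from this have "i < k" unfolding has_type_def type_cond_def by simp
    ultimately show ?thesis using that unfolding type_family_def by force
  qed
  then show "F = (\<Union>i\<in>{0..k - 1}. type_family k F i)"
    by (auto simp: type_family_def)
  show "\<forall>i\<in>{0..k - 1}. \<forall>S\<in>type_family k F i.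
       card (S \<inter> {1..2 * k - i - 1}) = k - i \<and> 2 * k - i \<notin> S"
  proof (intro ballI)
    fix i S assume "S \<in> type_family k F i"
    then have "S \<in> F" and t: "has_type k S i" unfolding type_family_def by auto
    then have "S \<subseteq> {1..n}" "card S = k"
      using assms(3) unfolding uniform_system_def by auto
    then show "card (S \<inter> {1..2 * k - i - 1}) = k - i \<and> 2 * k - i \<notin> S"
      using has_type_exact[OF _ _ t] finite_subset by blast
  qed
qed

end
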